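(* Let $R$ be a commutative unital ring. The Lie algebras $\mathfrak{gl}_{cf}(\mathbb{N},R)$ and $\mathfrak{gl}_{cf}(\mathbb{Z},R)$ are isomorphic.
   Context: $\mathbb{N}$ denotes the positive integers; rings are associative. For an index set $I\in\{\mathbb{N},\mathbb{Z}\}$, $\mathfrak{gl}_{cf}(I,R)$ is the set of all $I\times I$ matrices over $R$ having only finitely many nonzero entries in each column, regarded as a Lie algebra over $R$ with $[A,B]=AB-BA$. *)

theory Defs
  imports "HOL-Algebra.Module"
begin

record ('a, 'b) lie_ring_module = "('a, 'b) module" +
  lie_bracket :: "'b \<Rightarrow> 'b \<Rightarrow> 'b"

text \<open>
  The fields \<open>mult\<close> and \<open>one\<close> inherited from the record of modules play no role in the notions of
  Lie algebra and of Lie algebra isomorphism, exactly as in the library's locale \<open>module\<close>.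
\<close>

locale lie_algebra = module R L
  for R :: "('a, 'r) ring_scheme" (structure)
    and L :: "('a, 'b, 'm) lie_ring_module_scheme" (structure) +
  assumes lie_closed:
      "\<lbrakk>x \<in> carrier L; y \<in> carrier L\<rbrakk> \<Longrightarrow> lie_bracket L x y \<in> carrier L"
    and lie_add_left:
      "\<lbrakk>x \<in> carrier L; y \<in> carrier L; z \<in> carrier L\<rbrakk> \<Longrightarrow>
        lie_bracket L (x \<oplus>\<^bsub>L\<^esub> y) z = lie_bracket L x z \<oplus>\<^bsub>L\<^esub> lie_bracket L y z"
    and lie_add_right:
      "\<lbrakk>x \<in> carrier L; y \<in> carrier L; z \<in> carrier L\<rbrakk> \<Longrightarrow>
        lie_bracket L x (y \<oplus>\<^bsub>L\<^esub> z) = lie_bracket L x y \<oplus>\<^bsub>L\<^esub> lie_bracket L x z"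
    and lie_smult_left:
      "\<lbrakk>r \<in> carrier R; x \<in> carrier L; y \<in> carrier L\<rbrakk> \<Longrightarrow>
        lie_bracket L (r \<odot>\<^bsub>L\<^esub> x) y = r \<odot>\<^bsub>L\<^esub> lie_bracket L x y"
    and lie_smult_right:
      "\<lbrakk>r \<in> carrier R; x \<in> carrier L; y \<in> carrier L\<rbrakk> \<Longrightarrow>
        lie_bracket L x (r \<odot>\<^bsub>L\<^esub> y) = r \<odot>\<^bsub>L\<^esub> lie_bracket L x y"
    and lie_self: "x \<in> carrier L \<Longrightarrow> lie_bracket L x x = \<zero>\<^bsub>L\<^esub>"
    and jacobi:
      "\<lbrakk>x \<in> carrier L; y \<in> carrier L; z \<in> carrier L\<rbrakk> \<Longrightarrow>
        lie_bracket L x (lie_bracket L y z) \<oplus>\<^bsub>L\<^esub>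
        (lie_bracket L y (lie_bracket L z x) \<oplus>\<^bsub>L\<^esub> lie_bracket L z (lie_bracket L x y)) = \<zero>\<^bsub>L\<^esub>"

definition lie_algebra_hom ::
  "('a, 'r) ring_scheme \<Rightarrow> ('a, 'b, 'm) lie_ring_module_scheme \<Rightarrow>
    ('a, 'c, 'n) lie_ring_module_scheme \<Rightarrow> ('b \<Rightarrow> 'c) set" where
  "lie_algebra_hom R L M = {\<phi>. \<phi> \<in> carrier L \<rightarrow> carrier M \<and>
     (\<forall>x\<in>carrier L. \<forall>y\<in>carrier L. \<phi> (x \<oplus>\<^bsub>L\<^esub> y) = \<phi> x \<oplus>\<^bsub>M\<^esub> \<phi> y) \<and>
     (\<forall>r\<in>carrier R. \<forall>x\<in>carrier L. \<phi> (r \<odot>\<^bsub>L\<^esub> x) = r \<odot>\<^bsub>M\<^esub> \<phi> x) \<and>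
     (\<forall>x\<in>carrier L. \<forall>y\<in>carrier L. \<phi> (lie_bracket L x y) = lie_bracket M (\<phi> x) (\<phi> y))}"

definition lie_algebra_iso ::
  "('a, 'r) ring_scheme \<Rightarrow> ('a, 'b, 'm) lie_ring_module_scheme \<Rightarrow>
    ('a, 'c, 'n) lie_ring_module_scheme \<Rightarrow> ('b \<Rightarrow> 'c) set" where
  "lie_algebra_iso R L M = {\<phi> \<in> lie_algebra_hom R L M. bij_betw \<phi> (carrier L) (carrier M)}"

definition lie_algebras_isomorphic ::
  "('a, 'r) ring_scheme \<Rightarrow> ('a, 'b, 'm) lie_ring_module_scheme \<Rightarrow>
    ('a, 'c, 'n) lie_ring_module_scheme \<Rightarrow> bool" where
  "lie_algebras_isomorphic R L M \<longleftrightarrow> lie_algebra_iso R L M \<noteq> {}"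

text \<open>
  The sum in a matrix product is restricted to the row indices of the nonzero entries in a column
  of the right factor: \<open>finsum\<close> is only meaningful over finite sets, and all
  omitted summands vanish.
\<close>

definition cf_mat :: "'i set \<Rightarrow> ('a, 'r) ring_scheme \<Rightarrow> ('a, 'i \<times> 'i \<Rightarrow> 'a) module" where
  "cf_mat I R = \<lparr>
     carrier = {A \<in> I \<times> I \<rightarrow>\<^sub>E carrier R. \<forall>j\<in>I. finite {i \<in> I. A (i, j) \<noteq> \<zero>\<^bsub>R\<^esub>}},
     mult = (\<lambda>A B. \<lambda>(i, j)\<in>I \<times> I.
       \<Oplus>\<^bsub>R\<^esub>k\<in>{k \<in> I. B (k, j) \<noteq> \<zero>\<^bsub>R\<^esub>}. A (i, k) \<otimes>\<^bsub>R\<^esub> B (k, j)),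
     one = (\<lambda>(i, j)\<in>I \<times> I. if i = j then \<one>\<^bsub>R\<^esub> else \<zero>\<^bsub>R\<^esub>),
     zero = (\<lambda>(i, j)\<in>I \<times> I. \<zero>\<^bsub>R\<^esub>),
     add = (\<lambda>A B. \<lambda>(i, j)\<in>I \<times> I. A (i, j) \<oplus>\<^bsub>R\<^esub> B (i, j)),
     smult = (\<lambda>r A. \<lambda>(i, j)\<in>I \<times> I. r \<otimes>\<^bsub>R\<^esub> A (i, j))\<rparr>"

definition gl_cf :: "'i set \<Rightarrow> ('a, 'r) ring_scheme \<Rightarrow> ('a, 'i \<times> 'i \<Rightarrow> 'a) lie_ring_module" where
  "gl_cf I R = module.extend (cf_mat I R)
     (lie_ring_module.fields
       (\<lambda>A B. (A \<otimes>\<^bsub>cf_mat I R\<^esub> B) \<ominus>\<^bsub>cf_mat I R\<^esub> (B \<otimes>\<^bsub>cf_mat I R\<^esub> A)))"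

lemma gl_cf_simps [simp]:
  "carrier (gl_cf I R) = carrier (cf_mat I R)"
  "add (gl_cf I R) = add (cf_mat I R)"
  "\<zero>\<^bsub>gl_cf I R\<^esub> = \<zero>\<^bsub>cf_mat I R\<^esub>"
  "smult (gl_cf I R) = smult (cf_mat I R)"
  "lie_bracket (gl_cf I R) A B =
     (A \<otimes>\<^bsub>cf_mat I R\<^esub> B) \<ominus>\<^bsub>cf_mat I R\<^esub> (B \<otimes>\<^bsub>cf_mat I R\<^esub> A)"
  by (simp_all add: gl_cf_def module.defs lie_ring_module.defs)

context ring
begin

lemma commutator_jacobi:
  assumes "x \<in> carrier R" "y \<in> carrier R" "z \<in> carrier R"
  shows "(x \<otimes> (y \<otimes> z \<ominus> z \<otimes> y) \<ominus> (y \<otimes> z \<ominus> z \<otimes> y) \<otimes> x) \<oplus>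
    ((y \<otimes> (z \<otimes> x \<ominus> x \<otimes> z) \<ominus> (z \<otimes> x \<ominus> x \<otimes> z) \<otimes> y) \<oplus>
     (z \<otimes> (x \<otimes> y \<ominus> y \<otimes> x) \<ominus> (x \<otimes> y \<ominus> y \<otimes> x) \<otimes> z)) = \<zero>"
proof -
  have *: "a \<ominus> b \<ominus> (c \<ominus> d) \<oplus> (c \<ominus> e \<ominus> (f \<ominus> b) \<oplus> (f \<ominus> d \<ominus> (a \<ominus> e))) = \<zero>"
    if "a \<in> carrier R" "b \<in> carrier R" "c \<in> carrier R" "d \<in> carrier R" "e \<in> carrier R" "f \<in> carrier R"
    for a b c d e f
    using that r_neg[of "a \<oplus> (b \<oplus> (c \<oplus> (d \<oplus> (e \<oplus> f))))"]
    by (simp add: a_minus_def minus_add a_ac)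
  show ?thesis
    using assms *[of "x \<otimes> (y \<otimes> z)" "x \<otimes> (z \<otimes> y)" "y \<otimes> (z \<otimes> x)" "z \<otimes> (y \<otimes> x)" "y \<otimes> (x \<otimes> z)" "z \<otimes> (x \<otimes> y)"]
    by (simp add: a_minus_def r_distr l_distr r_minus l_minus m_assoc)
qed

lemma commutator_add:
  assumes "x \<in> carrier R" "y \<in> carrier R" "z \<in> carrier R"
  shows "(x \<oplus> y) \<otimes> z \<ominus> z \<otimes> (x \<oplus> y) = (x \<otimes> z \<ominus> z \<otimes> x) \<oplus> (y \<otimes> z \<ominus> z \<otimes> y)"
    and "z \<otimes> (x \<oplus> y) \<ominus> (x \<oplus> y) \<otimes> z = (z \<otimes> x \<ominus> x \<otimes> z) \<oplus> (z \<otimes> y \<ominus> y \<otimes> z)"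
  using assms by (simp_all add: a_minus_def minus_add l_distr r_distr a_ac)

end

context cring
begin

lemma cf_mat_memI:
  assumes "\<And>i j. \<lbrakk>i \<in> I; j \<in> I\<rbrakk> \<Longrightarrow> f i j \<in> carrier R"
    and "\<And>j. j \<in> I \<Longrightarrow> finite {i \<in> I. f i j \<noteq> \<zero>}"
  shows "(\<lambda>(i, j)\<in>I \<times> I. f i j) \<in> carrier (cf_mat I R)"
proof -
  have "{i \<in> I. (\<lambda>(i, j)\<in>I \<times> I. f i j) (i, j) \<noteq> \<zero>} = {i \<in> I. f i j \<noteq> \<zero>}" if "j \<in> I" for j
    using that by auto
  then show ?thesis
    using assms by (auto simp: cf_mat_def)
qed

lemma cf_mat_entry [simp, intro]:
  "\<lbrakk>A \<in> carrier (cf_mat I R); i \<in> I; j \<in> I\<rbrakk> \<Longrightarrow> A (i, j) \<in> carrier R"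
  by (auto simp: cf_mat_def)

lemma cf_mat_finite:
  "\<lbrakk>A \<in> carrier (cf_mat I R); j \<in> I\<rbrakk> \<Longrightarrow> finite {i \<in> I. A (i, j) \<noteq> \<zero>}"
  by (auto simp: cf_mat_def)

lemma cf_mat_eqI:
  assumes "A \<in> carrier (cf_mat I R)" "B \<in> carrier (cf_mat I R)"
    and "\<And>i j. \<lbrakk>i \<in> I; j \<in> I\<rbrakk> \<Longrightarrow> A (i, j) = B (i, j)"
  shows "A = B"
  using assms by (intro PiE_ext[of A "I \<times> I" "\<lambda>_. carrier R" B]) (auto simp: cf_mat_def)

lemma cf_mat_entries:
  assumes "i \<in> I" "j \<in> I"
  shows "(A \<oplus>\<^bsub>cf_mat I R\<^esub> B) (i, j) = A (i, j) \<oplus> B (i, j)"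
    and "\<zero>\<^bsub>cf_mat I R\<^esub> (i, j) = \<zero>"
    and "\<one>\<^bsub>cf_mat I R\<^esub> (i, j) = (if i = j then \<one> else \<zero>)"
    and "(r \<odot>\<^bsub>cf_mat I R\<^esub> A) (i, j) = r \<otimes> A (i, j)"
  using assms by (auto simp: cf_mat_def)

lemma cf_mat_mult_entry:
  assumes A: "A \<in> carrier (cf_mat I R)" and B: "B \<in> carrier (cf_mat I R)"
    and ij: "i \<in> I" "j \<in> I"
    and S: "finite S" "S \<subseteq> I" "\<And>k. \<lbrakk>k \<in> I; B (k, j) \<noteq> \<zero>\<rbrakk> \<Longrightarrow> k \<in> S"
  shows "(A \<otimes>\<^bsub>cf_mat I R\<^esub> B) (i, j) = (\<Oplus>k\<in>S. A (i, k) \<otimes> B (k, j))"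
proof -
  have "(\<Oplus>k\<in>{k \<in> I. B (k, j) \<noteq> \<zero>}. A (i, k) \<otimes> B (k, j)) = (\<Oplus>k\<in>S. A (i, k) \<otimes> B (k, j))"
    using A B ij S
    by (intro add.finprod_mono_neutral_cong_left) (auto intro!: r_null)
  then show ?thesis
    using ij by (simp add: cf_mat_def)
qed

lemma cf_mat_add_closed:
  assumes "A \<in> carrier (cf_mat I R)" "B \<in> carrier (cf_mat I R)"
  shows "A \<oplus>\<^bsub>cf_mat I R\<^esub> B \<in> carrier (cf_mat I R)"
proof -
  have "finite {i \<in> I. A (i, j) \<oplus> B (i, j) \<noteq> \<zero>}" if "j \<in> I" for j
    by (rule finite_subset[of _ "{i \<in> I. A (i, j) \<noteq> \<zero>} \<union> {i \<in> I. B (i, j) \<noteq> \<zero>}"])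
      (use assms that in \<open>auto intro: cf_mat_finite\<close>)
  then have "(\<lambda>(i, j)\<in>I \<times> I. A (i, j) \<oplus> B (i, j)) \<in> carrier (cf_mat I R)"
    using assms by (intro cf_mat_memI) auto
  then show ?thesis by (simp add: cf_mat_def)
qed

lemma cf_mat_zero_closed: "\<zero>\<^bsub>cf_mat I R\<^esub> \<in> carrier (cf_mat I R)"
proof -
  have "(\<lambda>(i, j)\<in>I \<times> I. \<zero>) \<in> carrier (cf_mat I R)"
    by (intro cf_mat_memI) auto
  then show ?thesis by (simp add: cf_mat_def)
qed

lemma cf_mat_one_closed: "\<one>\<^bsub>cf_mat I R\<^esub> \<in> carrier (cf_mat I R)"
proof -
  have "finite {i \<in> I. (if i = j then \<one> else \<zero>) \<noteq> \<zero>}" for j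
    by (rule finite_subset[of _ "{j}"]) auto
  then have "(\<lambda>(i, j)\<in>I \<times> I. if i = j then \<one> else \<zero>) \<in> carrier (cf_mat I R)"
    by (intro cf_mat_memI) auto
  then show ?thesis by (simp add: cf_mat_def)
qed

lemma cf_mat_smult_closed:
  assumes "r \<in> carrier R" "A \<in> carrier (cf_mat I R)"
  shows "r \<odot>\<^bsub>cf_mat I R\<^esub> A \<in> carrier (cf_mat I R)"
proof -
  have "finite {i \<in> I. r \<otimes> A (i, j) \<noteq> \<zero>}" if "j \<in> I" for j
    by (rule finite_subset[of _ "{i \<in> I. A (i, j) \<noteq> \<zero>}"])
      (use assms that in \<open>auto intro: cf_mat_finite\<close>)
  then have "(\<lambda>(i, j)\<in>I \<times> I. r \<otimes> A (i, j)) \<in> carrier (cf_mat I R)"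
    using assms by (intro cf_mat_memI) auto
  then show ?thesis by (simp add: cf_mat_def)
qed

lemma cf_mat_mult_closed:
  assumes A: "A \<in> carrier (cf_mat I R)" and B: "B \<in> carrier (cf_mat I R)"
  shows "A \<otimes>\<^bsub>cf_mat I R\<^esub> B \<in> carrier (cf_mat I R)"
proof -
  let ?f = "\<lambda>i j. \<Oplus>k\<in>{k \<in> I. B (k, j) \<noteq> \<zero>}. A (i, k) \<otimes> B (k, j)"
  have "finite {i \<in> I. ?f i j \<noteq> \<zero>}" if j: "j \<in> I" for j
  proof (rule finite_subset)
    let ?U = "\<Union>k\<in>{k \<in> I. B (k, j) \<noteq> \<zero>}. {i \<in> I. A (i, k) \<noteq> \<zero>}"
    show "finite ?U"
      using A B j by (auto intro: cf_mat_finite)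
    show "{i \<in> I. ?f i j \<noteq> \<zero>} \<subseteq> ?U"
    proof
      fix i assume i: "i \<in> {i \<in> I. ?f i j \<noteq> \<zero>}"
      show "i \<in> ?U"
      proof (rule ccontr)
        assume "i \<notin> ?U"
        then have "?f i j = \<zero>"
          using i j B by (intro add.finprod_one_eqI) auto
        with i show False by simp
      qed
    qed
  qed
  then have "(\<lambda>(i, j)\<in>I \<times> I. ?f i j) \<in> carrier (cf_mat I R)"
    using A B by (intro cf_mat_memI) (auto intro!: finsum_closed)
  then show ?thesis by (simp add: cf_mat_def)
qed

lemmas cf_mat_closed =
  cf_mat_add_closed cf_mat_zero_closed cf_mat_one_closed cf_mat_smult_closed cf_mat_mult_closed

lemma cf_mat_abelian_group: "abelian_group (cf_mat I R)"
proof (rule abelian_groupI)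
  fix A assume A: "A \<in> carrier (cf_mat I R)"
  show "\<exists>B\<in>carrier (cf_mat I R). B \<oplus>\<^bsub>cf_mat I R\<^esub> A = \<zero>\<^bsub>cf_mat I R\<^esub>"
  proof
    show "(\<ominus> \<one>) \<odot>\<^bsub>cf_mat I R\<^esub> A \<in> carrier (cf_mat I R)"
      using A by (intro cf_mat_smult_closed) auto
    then show "((\<ominus> \<one>) \<odot>\<^bsub>cf_mat I R\<^esub> A) \<oplus>\<^bsub>cf_mat I R\<^esub> A = \<zero>\<^bsub>cf_mat I R\<^esub>"
      using A by (intro cf_mat_eqI) (auto intro!: cf_mat_closed simp: cf_mat_entries l_minus l_neg)
  qed
qed (auto intro!: cf_mat_closed cf_mat_eqI simp: cf_mat_entries a_ac)

lemma finsum_swap: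
  assumes "finite S" "finite T" "\<And>x y. \<lbrakk>x \<in> S; y \<in> T\<rbrakk> \<Longrightarrow> f x y \<in> carrier R"
  shows "(\<Oplus>x\<in>S. \<Oplus>y\<in>T. f x y) = (\<Oplus>y\<in>T. \<Oplus>x\<in>S. f x y)"
  using assms
proof (induction S rule: finite_induct)
  case empty
  then show ?case by simp
next
  case (insert x S)
  have "(\<Oplus>x\<in>insert x S. \<Oplus>y\<in>T. f x y) = (\<Oplus>y\<in>T. f x y) \<oplus> (\<Oplus>y\<in>T. \<Oplus>x\<in>S. f x y)"
    using insert by (simp add: Pi_def)
  also have "\<dots> = (\<Oplus>y\<in>T. f x y \<oplus> (\<Oplus>x\<in>S. f x y))"
    using insert by (intro finsum_addf[symmetric]) auto
  also have "\<dots> = (\<Oplus>y\<in>T. \<Oplus>x\<in>insert x S. f x y)"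
    using insert by (intro finsum_cong') auto
  finally show ?case .
qed

lemma cf_mat_mult_assoc:
  assumes A: "A \<in> carrier (cf_mat I R)" and B: "B \<in> carrier (cf_mat I R)"
    and C: "C \<in> carrier (cf_mat I R)"
  shows "(A \<otimes>\<^bsub>cf_mat I R\<^esub> B) \<otimes>\<^bsub>cf_mat I R\<^esub> C = A \<otimes>\<^bsub>cf_mat I R\<^esub> (B \<otimes>\<^bsub>cf_mat I R\<^esub> C)"
proof (rule cf_mat_eqI)
  fix i j assume i: "i \<in> I" and j: "j \<in> I"
  let ?M = "cf_mat I R"
  define T where "T = {l \<in> I. C (l, j) \<noteq> \<zero>}"
  define S where "S = (\<Union>l\<in>T. {k \<in> I. B (k, l) \<noteq> \<zero>})"
  have T: "finite T" "T \<subseteq> I" and S: "finite S" "S \<subseteq> I"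
    using B C j by (auto simp: T_def S_def intro: cf_mat_finite)
  have BC: "(B \<otimes>\<^bsub>?M\<^esub> C) (k, j) = (\<Oplus>l\<in>T. B (k, l) \<otimes> C (l, j))" if "k \<in> I" for k
    using B C that j T by (intro cf_mat_mult_entry) (auto simp: T_def)
  have BC0: "k \<in> S" if "k \<in> I" "(B \<otimes>\<^bsub>?M\<^esub> C) (k, j) \<noteq> \<zero>" for k
  proof (rule ccontr)
    assume "k \<notin> S"
    then have "(\<Oplus>l\<in>T. B (k, l) \<otimes> C (l, j)) = \<zero>"
      using that(1) j C T by (intro add.finprod_one_eqI) (auto simp: S_def intro!: l_null)
    with that BC show False by simp
  qed
  have mem: "A (i, k) \<in> carrier R" "B (k, l) \<in> carrier R" "C (l, j) \<in> carrier R"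
    if "k \<in> S" "l \<in> T" for k l
    using that A B C i j S T by auto
  have memA: "A (i, k) \<in> carrier R" if "k \<in> S" for k
    using that A i S by auto
  have memC: "C (l, j) \<in> carrier R" if "l \<in> T" for l
    using that C j T by auto
  have "((A \<otimes>\<^bsub>?M\<^esub> B) \<otimes>\<^bsub>?M\<^esub> C) (i, j) = (\<Oplus>l\<in>T. (A \<otimes>\<^bsub>?M\<^esub> B) (i, l) \<otimes> C (l, j))"
    using A B C i j T by (intro cf_mat_mult_entry cf_mat_closed) (auto simp: T_def)
  also have "\<dots> = (\<Oplus>l\<in>T. (\<Oplus>k\<in>S. A (i, k) \<otimes> B (k, l)) \<otimes> C (l, j))"
  proof (intro finsum_cong')
    fix l assume l: "l \<in> T"
    have "(A \<otimes>\<^bsub>?M\<^esub> B) (i, l) = (\<Oplus>k\<in>S. A (i, k) \<otimes> B (k, l))"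
      using A B i l T S by (intro cf_mat_mult_entry) (auto simp: S_def)
    then show "(A \<otimes>\<^bsub>?M\<^esub> B) (i, l) \<otimes> C (l, j) = (\<Oplus>k\<in>S. A (i, k) \<otimes> B (k, l)) \<otimes> C (l, j)"
      by simp
  qed (auto intro!: finsum_closed m_closed mem memC)
  also have "\<dots> = (\<Oplus>l\<in>T. \<Oplus>k\<in>S. A (i, k) \<otimes> (B (k, l) \<otimes> C (l, j)))"
  proof (intro finsum_cong')
    fix l assume l: "l \<in> T"
    have "(\<Oplus>k\<in>S. A (i, k) \<otimes> B (k, l)) \<otimes> C (l, j) = (\<Oplus>k\<in>S. A (i, k) \<otimes> B (k, l) \<otimes> C (l, j))"
      using l S by (intro finsum_ldistr) (auto simp: mem memC)
    also have "\<dots> = (\<Oplus>k\<in>S. A (i, k) \<otimes> (B (k, l) \<otimes> C (l, j)))"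
      using l by (intro finsum_cong') (auto simp: mem m_assoc)
    finally show "(\<Oplus>k\<in>S. A (i, k) \<otimes> B (k, l)) \<otimes> C (l, j)
      = (\<Oplus>k\<in>S. A (i, k) \<otimes> (B (k, l) \<otimes> C (l, j)))" .
  qed (auto intro!: finsum_closed m_closed mem memC)
  also have "\<dots> = (\<Oplus>k\<in>S. \<Oplus>l\<in>T. A (i, k) \<otimes> (B (k, l) \<otimes> C (l, j)))"
    by (intro finsum_swap S T) (auto simp: mem)
  also have "\<dots> = (\<Oplus>k\<in>S. A (i, k) \<otimes> (B \<otimes>\<^bsub>?M\<^esub> C) (k, j))"
  proof (intro finsum_cong')
    fix k assume k: "k \<in> S"
    have "(\<Oplus>l\<in>T. A (i, k) \<otimes> (B (k, l) \<otimes> C (l, j))) = A (i, k) \<otimes> (\<Oplus>l\<in>T. B (k, l) \<otimes> C (l, j))"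
      using k T by (intro finsum_rdistr[symmetric]) (auto simp: mem memA)
    then show "(\<Oplus>l\<in>T. A (i, k) \<otimes> (B (k, l) \<otimes> C (l, j))) = A (i, k) \<otimes> (B \<otimes>\<^bsub>?M\<^esub> C) (k, j)"
      using k S BC by auto
  next
    show "(\<lambda>k. A (i, k) \<otimes> (B \<otimes>\<^bsub>?M\<^esub> C) (k, j)) \<in> S \<rightarrow> carrier R"
      using B C S j by (auto intro!: m_closed memA cf_mat_entry cf_mat_closed)
  qed simp
  also have "\<dots> = (A \<otimes>\<^bsub>?M\<^esub> (B \<otimes>\<^bsub>?M\<^esub> C)) (i, j)"
    using A B C i j S BC0 by (intro cf_mat_mult_entry[symmetric] cf_mat_closed) auto
  finally show "((A \<otimes>\<^bsub>?M\<^esub> B) \<otimes>\<^bsub>?M\<^esub> C) (i, j) = (A \<otimes>\<^bsub>?M\<^esub> (B \<otimes>\<^bsub>?M\<^esub> C)) (i, j)" .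
qed (use assms in \<open>auto intro!: cf_mat_closed\<close>)

lemma cf_mat_one_mult:
  assumes A: "A \<in> carrier (cf_mat I R)"
  shows "\<one>\<^bsub>cf_mat I R\<^esub> \<otimes>\<^bsub>cf_mat I R\<^esub> A = A" "A \<otimes>\<^bsub>cf_mat I R\<^esub> \<one>\<^bsub>cf_mat I R\<^esub> = A"
proof -
  let ?M = "cf_mat I R"
  have *: "(\<one>\<^bsub>?M\<^esub> \<otimes>\<^bsub>?M\<^esub> A) (i, j) = A (i, j) \<and> (A \<otimes>\<^bsub>?M\<^esub> \<one>\<^bsub>?M\<^esub>) (i, j) = A (i, j)"
    if ij: "i \<in> I" "j \<in> I" for i j
  proof
    let ?S = "insert i {k \<in> I. A (k, j) \<noteq> \<zero>}"
    have fin: "finite ?S" using A ij by (auto intro: cf_mat_finite)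
    have "(\<one>\<^bsub>?M\<^esub> \<otimes>\<^bsub>?M\<^esub> A) (i, j) = (\<Oplus>k\<in>?S. \<one>\<^bsub>?M\<^esub> (i, k) \<otimes> A (k, j))"
      using A ij fin by (intro cf_mat_mult_entry cf_mat_closed) auto
    also have "\<dots> = (\<Oplus>k\<in>?S. if i = k then A (k, j) else \<zero>)"
      using A ij by (intro finsum_cong') (auto simp: cf_mat_entries)
    also have "\<dots> = A (i, j)"
      using A ij fin by (intro finsum_singleton) auto
    finally show "(\<one>\<^bsub>?M\<^esub> \<otimes>\<^bsub>?M\<^esub> A) (i, j) = A (i, j)" .
    have "(A \<otimes>\<^bsub>?M\<^esub> \<one>\<^bsub>?M\<^esub>) (i, j) = (\<Oplus>k\<in>{j}. A (i, k) \<otimes> \<one>\<^bsub>?M\<^esub> (k, j))"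
      using A ij by (intro cf_mat_mult_entry cf_mat_closed) (auto simp: cf_mat_entries split: if_splits)
    also have "\<dots> = A (i, j)"
      using A ij by (simp add: cf_mat_entries)
    finally show "(A \<otimes>\<^bsub>?M\<^esub> \<one>\<^bsub>?M\<^esub>) (i, j) = A (i, j)" .
  qed
  show "\<one>\<^bsub>?M\<^esub> \<otimes>\<^bsub>?M\<^esub> A = A" "A \<otimes>\<^bsub>?M\<^esub> \<one>\<^bsub>?M\<^esub> = A"
    using * A by (auto intro!: cf_mat_eqI cf_mat_closed)
qed

lemma cf_mat_distr:
  assumes A: "A \<in> carrier (cf_mat I R)" and B: "B \<in> carrier (cf_mat I R)"
    and C: "C \<in> carrier (cf_mat I R)"
  shows "(A \<oplus>\<^bsub>cf_mat I R\<^esub> B) \<otimes>\<^bsub>cf_mat I R\<^esub> C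
      = (A \<otimes>\<^bsub>cf_mat I R\<^esub> C) \<oplus>\<^bsub>cf_mat I R\<^esub> (B \<otimes>\<^bsub>cf_mat I R\<^esub> C)"
    and "C \<otimes>\<^bsub>cf_mat I R\<^esub> (A \<oplus>\<^bsub>cf_mat I R\<^esub> B)
      = (C \<otimes>\<^bsub>cf_mat I R\<^esub> A) \<oplus>\<^bsub>cf_mat I R\<^esub> (C \<otimes>\<^bsub>cf_mat I R\<^esub> B)"
proof -
  let ?M = "cf_mat I R"
  have *: "((A \<oplus>\<^bsub>?M\<^esub> B) \<otimes>\<^bsub>?M\<^esub> C) (i, j) = (A \<otimes>\<^bsub>?M\<^esub> C) (i, j) \<oplus> (B \<otimes>\<^bsub>?M\<^esub> C) (i, j) \<and>
      (C \<otimes>\<^bsub>?M\<^esub> (A \<oplus>\<^bsub>?M\<^esub> B)) (i, j) = (C \<otimes>\<^bsub>?M\<^esub> A) (i, j) \<oplus> (C \<otimes>\<^bsub>?M\<^esub> B) (i, j)"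
    if ij: "i \<in> I" "j \<in> I" for i j
  proof -
    define S where "S = {k \<in> I. A (k, j) \<noteq> \<zero>} \<union> {k \<in> I. B (k, j) \<noteq> \<zero>} \<union> {k \<in> I. C (k, j) \<noteq> \<zero>}"
    have S: "finite S" "S \<subseteq> I"
      using A B C ij by (auto simp: S_def intro: cf_mat_finite)
    have mult: "(X \<otimes>\<^bsub>?M\<^esub> Y) (i, j) = (\<Oplus>k\<in>S. X (i, k) \<otimes> Y (k, j))"
      if "X \<in> carrier ?M" "Y \<in> {A, B, C, A \<oplus>\<^bsub>?M\<^esub> B}" for X Y
      using that A B C ij S
      by (intro cf_mat_mult_entry) (auto simp: S_def cf_mat_entries intro!: cf_mat_closed)
    have mem: "A (i, k) \<in> carrier R" "B (i, k) \<in> carrier R" "C (i, k) \<in> carrier R"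
       "A (k, j) \<in> carrier R" "B (k, j) \<in> carrier R" "C (k, j) \<in> carrier R" if "k \<in> S" for k
      using that A B C ij S by auto
    have "((A \<oplus>\<^bsub>?M\<^esub> B) \<otimes>\<^bsub>?M\<^esub> C) (i, j)
        = (\<Oplus>k\<in>S. A (i, k) \<otimes> C (k, j) \<oplus> B (i, k) \<otimes> C (k, j))"
      unfolding mult[OF cf_mat_add_closed[OF A B], of C, simplified]
      using ij S by (intro finsum_cong') (auto simp: mem cf_mat_entries l_distr subset_iff)
    also have "\<dots> = (A \<otimes>\<^bsub>?M\<^esub> C) (i, j) \<oplus> (B \<otimes>\<^bsub>?M\<^esub> C) (i, j)"
      using A B by (simp add: mult finsum_addf mem Pi_def)
    finally have 1: "((A \<oplus>\<^bsub>?M\<^esub> B) \<otimes>\<^bsub>?M\<^esub> C) (i, j)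
        = (A \<otimes>\<^bsub>?M\<^esub> C) (i, j) \<oplus> (B \<otimes>\<^bsub>?M\<^esub> C) (i, j)" .
    have "(C \<otimes>\<^bsub>?M\<^esub> (A \<oplus>\<^bsub>?M\<^esub> B)) (i, j)
        = (\<Oplus>k\<in>S. C (i, k) \<otimes> A (k, j) \<oplus> C (i, k) \<otimes> B (k, j))"
      unfolding mult[OF C, of "A \<oplus>\<^bsub>?M\<^esub> B", simplified]
      using ij S by (intro finsum_cong') (auto simp: mem cf_mat_entries r_distr subset_iff)
    also have "\<dots> = (C \<otimes>\<^bsub>?M\<^esub> A) (i, j) \<oplus> (C \<otimes>\<^bsub>?M\<^esub> B) (i, j)"
      using C by (simp add: mult finsum_addf mem Pi_def)
    finally show ?thesis using 1 by simp
  qed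
  show "(A \<oplus>\<^bsub>?M\<^esub> B) \<otimes>\<^bsub>?M\<^esub> C = (A \<otimes>\<^bsub>?M\<^esub> C) \<oplus>\<^bsub>?M\<^esub> (B \<otimes>\<^bsub>?M\<^esub> C)"
    "C \<otimes>\<^bsub>?M\<^esub> (A \<oplus>\<^bsub>?M\<^esub> B) = (C \<otimes>\<^bsub>?M\<^esub> A) \<oplus>\<^bsub>?M\<^esub> (C \<otimes>\<^bsub>?M\<^esub> B)"
    using * A B C by (auto intro!: cf_mat_eqI cf_mat_closed simp: cf_mat_entries)
qed

lemma cf_mat_ring: "ring (cf_mat I R)"
  by (intro ringI cf_mat_abelian_group monoidI)
    (auto intro!: cf_mat_closed simp: cf_mat_mult_assoc cf_mat_one_mult cf_mat_distr)

lemma cf_mat_smult_mult: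
  assumes r: "r \<in> carrier R" and A: "A \<in> carrier (cf_mat I R)" and B: "B \<in> carrier (cf_mat I R)"
  shows "(r \<odot>\<^bsub>cf_mat I R\<^esub> A) \<otimes>\<^bsub>cf_mat I R\<^esub> B = r \<odot>\<^bsub>cf_mat I R\<^esub> (A \<otimes>\<^bsub>cf_mat I R\<^esub> B)"
    and "A \<otimes>\<^bsub>cf_mat I R\<^esub> (r \<odot>\<^bsub>cf_mat I R\<^esub> B) = r \<odot>\<^bsub>cf_mat I R\<^esub> (A \<otimes>\<^bsub>cf_mat I R\<^esub> B)"
proof -
  let ?M = "cf_mat I R"
  have *: "((r \<odot>\<^bsub>?M\<^esub> A) \<otimes>\<^bsub>?M\<^esub> B) (i, j) = r \<otimes> (A \<otimes>\<^bsub>?M\<^esub> B) (i, j) \<and>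
      (A \<otimes>\<^bsub>?M\<^esub> (r \<odot>\<^bsub>?M\<^esub> B)) (i, j) = r \<otimes> (A \<otimes>\<^bsub>?M\<^esub> B) (i, j)"
    if ij: "i \<in> I" "j \<in> I" for i j
  proof -
    define S where "S = {k \<in> I. B (k, j) \<noteq> \<zero>}"
    have S: "finite S" "S \<subseteq> I"
      using B ij by (auto simp: S_def intro: cf_mat_finite)
    have mult: "(X \<otimes>\<^bsub>?M\<^esub> Y) (i, j) = (\<Oplus>k\<in>S. X (i, k) \<otimes> Y (k, j))"
      if "X \<in> carrier ?M" "Y \<in> {B, r \<odot>\<^bsub>?M\<^esub> B}" for X Y
      using that r B ij S
      by (intro cf_mat_mult_entry) (auto simp: S_def cf_mat_entries intro!: cf_mat_closed)
    have mem: "A (i, k) \<in> carrier R" "B (k, j) \<in> carrier R" if "k \<in> S" for k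
      using that A B ij S by auto
    have rd: "r \<otimes> (A \<otimes>\<^bsub>?M\<^esub> B) (i, j) = (\<Oplus>k\<in>S. r \<otimes> (A (i, k) \<otimes> B (k, j)))"
      using A S r by (simp add: mult) (intro finsum_rdistr, auto simp: mem)
    have "((r \<odot>\<^bsub>?M\<^esub> A) \<otimes>\<^bsub>?M\<^esub> B) (i, j) = (\<Oplus>k\<in>S. r \<otimes> (A (i, k) \<otimes> B (k, j)))"
      unfolding mult[OF cf_mat_smult_closed[OF r A], of B, simplified]
      using ij S r by (intro finsum_cong') (auto simp: mem cf_mat_entries m_assoc subset_iff)
    moreover have "(A \<otimes>\<^bsub>?M\<^esub> (r \<odot>\<^bsub>?M\<^esub> B)) (i, j) = (\<Oplus>k\<in>S. r \<otimes> (A (i, k) \<otimes> B (k, j)))"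
      unfolding mult[OF A, of "r \<odot>\<^bsub>?M\<^esub> B", simplified]
      using ij S r by (intro finsum_cong') (auto simp: mem cf_mat_entries m_lcomm subset_iff)
    ultimately show ?thesis using rd by simp
  qed
  show "(r \<odot>\<^bsub>?M\<^esub> A) \<otimes>\<^bsub>?M\<^esub> B = r \<odot>\<^bsub>?M\<^esub> (A \<otimes>\<^bsub>?M\<^esub> B)"
    "A \<otimes>\<^bsub>?M\<^esub> (r \<odot>\<^bsub>?M\<^esub> B) = r \<odot>\<^bsub>?M\<^esub> (A \<otimes>\<^bsub>?M\<^esub> B)"
    using * r A B by (auto intro!: cf_mat_eqI cf_mat_closed simp: cf_mat_entries)
qed

lemma cf_mat_module: "module R (cf_mat I R)"
  by (intro moduleI is_cring cf_mat_abelian_group)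
    (auto intro!: cf_mat_eqI cf_mat_closed simp: cf_mat_entries l_distr r_distr m_assoc)

theorem gl_cf_lie_algebra: "lie_algebra R (gl_cf I R)"
proof -
  let ?M = "cf_mat I R" and ?L = "gl_cf I R"
  interpret M: ring ?M by (rule cf_mat_ring)
  interpret M: module R ?M by (rule cf_mat_module)
  have "abelian_group ?L"
    by (rule abelian_groupI) (auto simp: M.a_ac intro: M.add.l_inv_ex)
  then interpret L: module R ?L
    by (intro moduleI is_cring)
      (auto simp: M.smult_l_distr M.smult_r_distr M.smult_assoc1)
  show ?thesis
  proof (unfold_locales, goal_cases)
    case (1 x y)
    then show ?case by simp
  next
    case (2 x y z)
    then show ?case by (simp add: M.commutator_add)
  next
    case (3 x y z)
    then show ?case by (simp add: M.commutator_add)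
  next
    case (4 r x y)
    then show ?case
      by (simp add: cf_mat_smult_mult a_minus_def M.smult_r_distr M.smult_r_minus)
  next
    case (5 r x y)
    then show ?case
      by (simp add: cf_mat_smult_mult a_minus_def M.smult_r_distr M.smult_r_minus)
  next
    case (6 x)
    then show ?case by (simp add: a_minus_def M.r_neg)
  next
    case (7 x y z)
    then show ?case by (simp add: M.commutator_jacobi)
  qed
qed

end

end

theory Submission
  imports Defs "HOL-Algebra.RingHom" "HOL-Library.Nat_Bijection"
begin

text \<open>
  The index set enters the definition of the column-finite matrices only as a set, without any order
  or arithmetic. A bijection \<open>g\<close> from \<open>J\<close> to \<open>I\<close> therefore transports all structure by
  renaming indices: \<open>A\<close> goes to the matrix with entries \<open>A (g i, g j)\<close>. Renaming maps the support
  of a column bijectively to the support of a column, so it preserves column-finiteness, and it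
  merely reindexes the finite sums in a matrix product (\<open>reindex_mult\<close>). It is thus an isomorphism
  of associative \<open>R\<close>-algebras, and as such an isomorphism of the commutator Lie algebras
  (\<open>gl_cf_isomorphic_of_bij\<close>). It remains that the positive integers and the
  integers are equinumerous.
\<close>

definition reindex :: "('j \<Rightarrow> 'i) \<Rightarrow> 'j set \<Rightarrow> ('i \<times> 'i \<Rightarrow> 'a) \<Rightarrow> 'j \<times> 'j \<Rightarrow> 'a" where
  "reindex g J A = (\<lambda>(i, j)\<in>J \<times> J. A (g i, g j))"

lemma reindex_entry [simp]: "\<lbrakk>i \<in> J; j \<in> J\<rbrakk> \<Longrightarrow> reindex g J A (i, j) = A (g i, g j)"
  by (simp add: reindex_def)

context cring
begin

text \<open>
  Injectivity of \<open>g\<close> is what keeps the columns finite: it bounds a column support of the new matrix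
  by one of the old matrix.
\<close>

lemma reindex_closed:
  assumes g: "bij_betw g J I" and A: "A \<in> carrier (cf_mat I R)"
  shows "reindex g J A \<in> carrier (cf_mat J R)"
  unfolding reindex_def
proof (rule cf_mat_memI)
  have gI: "g j \<in> I" if "j \<in> J" for j
    using g that by (rule bij_betw_apply)
  show "A (g i, g j) \<in> carrier R" if "i \<in> J" "j \<in> J" for i j
    using A gI that by auto
  show "finite {i \<in> J. A (g i, g j) \<noteq> \<zero>}" if "j \<in> J" for j
  proof (rule inj_on_finite)
    show "inj_on g {i \<in> J. A (g i, g j) \<noteq> \<zero>}"
      by (rule inj_on_subset[OF bij_betw_imp_inj_on[OF g]]) auto
    show "g ` {i \<in> J. A (g i, g j) \<noteq> \<zero>} \<subseteq> {i \<in> I. A (i, g j) \<noteq> \<zero>}"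
      using gI by auto
    show "finite {i \<in> I. A (i, g j) \<noteq> \<zero>}"
      using A gI that by (auto intro: cf_mat_finite)
  qed
qed

lemma reindex_add:
  assumes g: "bij_betw g J I" and A: "A \<in> carrier (cf_mat I R)" and B: "B \<in> carrier (cf_mat I R)"
  shows "reindex g J (A \<oplus>\<^bsub>cf_mat I R\<^esub> B) = reindex g J A \<oplus>\<^bsub>cf_mat J R\<^esub> reindex g J B"
  using A B
  by (intro cf_mat_eqI)
    (auto intro!: cf_mat_closed reindex_closed[OF g] simp: cf_mat_entries bij_betw_apply[OF g])

lemma reindex_smult:
  assumes g: "bij_betw g J I" and r: "r \<in> carrier R" and A: "A \<in> carrier (cf_mat I R)"
  shows "reindex g J (r \<odot>\<^bsub>cf_mat I R\<^esub> A) = r \<odot>\<^bsub>cf_mat J R\<^esub> reindex g J A"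
  using r A
  by (intro cf_mat_eqI)
    (auto intro!: cf_mat_closed reindex_closed[OF g] simp: cf_mat_entries bij_betw_apply[OF g])

lemma reindex_one:
  assumes g: "bij_betw g J I"
  shows "reindex g J \<one>\<^bsub>cf_mat I R\<^esub> = \<one>\<^bsub>cf_mat J R\<^esub>"
  by (intro cf_mat_eqI)
    (auto intro!: cf_mat_closed reindex_closed[OF g]
      simp: cf_mat_entries bij_betw_apply[OF g] inj_on_eq_iff[OF bij_betw_imp_inj_on[OF g]])

text \<open>
  With \<open>S\<close> the support of column \<open>j\<close> of the renamed \<open>B\<close>, surjectivity of \<open>g\<close> makes \<open>g ` S\<close> cover
  the support of column \<open>g j\<close> of \<open>B\<close>. So one entry is a sum over \<open>g ` S\<close> and the other a sum over
  \<open>S\<close>, with summands that correspond along the injective map \<open>g\<close>.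
\<close>

lemma reindex_mult:
  assumes g: "bij_betw g J I" and A: "A \<in> carrier (cf_mat I R)" and B: "B \<in> carrier (cf_mat I R)"
  shows "reindex g J (A \<otimes>\<^bsub>cf_mat I R\<^esub> B) = reindex g J A \<otimes>\<^bsub>cf_mat J R\<^esub> reindex g J B"
proof (rule cf_mat_eqI)
  fix i j assume i: "i \<in> J" and j: "j \<in> J"
  have gI: "g k \<in> I" if "k \<in> J" for k
    using g that by (rule bij_betw_apply)
  define S where "S = {k \<in> J. reindex g J B (k, j) \<noteq> \<zero>}"
  have S: "finite S" "S \<subseteq> J"
    using cf_mat_finite[OF reindex_closed[OF g B] j] by (auto simp: S_def)
  have cover: "k \<in> g ` S" if "k \<in> I" "B (k, g j) \<noteq> \<zero>" for k
  proof -
    from that(1) obtain l where "l \<in> J" "k = g l"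
      using bij_betw_imp_surj_on[OF g] by blast
    with that(2) j show ?thesis by (auto simp: S_def)
  qed
  have "reindex g J (A \<otimes>\<^bsub>cf_mat I R\<^esub> B) (i, j) = (\<Oplus>k\<in>g ` S. A (g i, k) \<otimes> B (k, g j))"
    using i j S gI cover by (subst reindex_entry) (auto intro!: cf_mat_mult_entry[OF A B])
  also have "\<dots> = (\<Oplus>k\<in>S. A (g i, g k) \<otimes> B (g k, g j))"
    using A B i j S gI inj_on_subset[OF bij_betw_imp_inj_on[OF g] S(2)]
    by (intro finsum_reindex) (auto simp: subset_iff)
  also have "\<dots> = (\<Oplus>k\<in>S. reindex g J A (i, k) \<otimes> reindex g J B (k, j))"
    using A B i j S gI by (intro finsum_cong') (auto simp: subset_iff)
  also have "\<dots> = (reindex g J A \<otimes>\<^bsub>cf_mat J R\<^esub> reindex g J B) (i, j)"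
    using A B i j S
    by (intro cf_mat_mult_entry[symmetric] reindex_closed[OF g]) (auto simp: S_def)
  finally show "reindex g J (A \<otimes>\<^bsub>cf_mat I R\<^esub> B) (i, j)
      = (reindex g J A \<otimes>\<^bsub>cf_mat J R\<^esub> reindex g J B) (i, j)" .
qed (use A B in \<open>auto intro!: cf_mat_closed reindex_closed[OF g]\<close>)

lemma reindex_inverse:
  assumes g: "bij_betw g J I" and h: "bij_betw h I J" and gh: "\<And>i. i \<in> I \<Longrightarrow> g (h i) = i"
    and A: "A \<in> carrier (cf_mat I R)"
  shows "reindex h I (reindex g J A) = A"
  using A
  by (intro cf_mat_eqI) (auto intro!: reindex_closed[OF g] reindex_closed[OF h]
      simp: bij_betw_apply[OF h] gh)

lemma reindex_bij_betw:
  assumes g: "bij_betw g J I"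
  shows "bij_betw (reindex g J) (carrier (cf_mat I R)) (carrier (cf_mat J R))"
proof -
  let ?h = "inv_into J g"
  have h: "bij_betw ?h I J"
    using g by (rule bij_betw_inv_into)
  have "g (?h i) = i" if "i \<in> I" for i
    using g that by (rule bij_betw_inv_into_right)
  moreover have "?h (g j) = j" if "j \<in> J" for j
    using g that by (rule bij_betw_inv_into_left)
  ultimately show ?thesis
    by (intro bij_betw_byWitness[where f' = "reindex ?h I"])
      (auto simp: reindex_inverse[OF g h] reindex_inverse[OF h g]
        intro: reindex_closed[OF g] reindex_closed[OF h])
qed

lemma reindex_ring_hom:
  assumes "bij_betw g J I"
  shows "reindex g J \<in> ring_hom (cf_mat I R) (cf_mat J R)"
  using assms by (intro ring_hom_memI reindex_closed reindex_mult reindex_add reindex_one)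

theorem gl_cf_isomorphic_of_bij:
  assumes g: "bij_betw g J I"
  shows "lie_algebras_isomorphic R (gl_cf I R) (gl_cf J R)"
proof -
  interpret I: ring "cf_mat I R" by (rule cf_mat_ring)
  interpret J: ring "cf_mat J R" by (rule cf_mat_ring)
  interpret hom: ring_hom_ring "cf_mat I R" "cf_mat J R" "reindex g J"
    by (intro ring_hom_ringI2 cf_mat_ring reindex_ring_hom[OF g])
  have "reindex g J \<in> lie_algebra_iso R (gl_cf I R) (gl_cf J R)"
    using reindex_bij_betw[OF g]
    by (auto simp: lie_algebra_iso_def lie_algebra_hom_def a_minus_def reindex_smult[OF g])
  then show ?thesis
    by (auto simp: lie_algebras_isomorphic_def)
qed

end

lemma bij_betw_int_positive_nat: "bij_betw (\<lambda>z. Suc (int_encode z)) UNIV {1..}"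
proof -
  have "bij_betw Suc UNIV {1..}"
    by (intro bij_betw_byWitness[where f' = "\<lambda>n. n - 1"]) auto
  with bij_int_encode have "bij_betw (Suc \<circ> int_encode) UNIV {1..}"
    by (rule bij_betw_trans)
  then show ?thesis by (simp add: comp_def)
qed

theorem proposition3p5:
  fixes R :: "('a, 'r) ring_scheme" (structure)
  assumes "cring R"
  shows "lie_algebras_isomorphic R (gl_cf {1::nat..} R) (gl_cf (UNIV :: int set) R)"
  using assms bij_betw_int_positive_nat by (rule cring.gl_cf_isomorphic_of_bij)

end
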